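(* Let $n\ge 2$ and let $v=(v_1,\ldots,v_n)$ be real numbers with $0\le v_1<v_2<\cdots<v_n$. The dimension of the hamiltonian circuit polytope $H_n(v)$ is $n-2$ if $n\in\{2,3\}$, and $n-1$ if $n\ge 4$.
   Context: A point $x=(x_1,\ldots,x_n)\in\{v_1,\ldots,v_n\}^n$ is a circuit (with respect to $v$) if the map $\sigma:\{1,\ldots,n\}\to\{1,\ldots,n\}$ defined by $x_i=v_{\sigma(i)}$ is a cyclic permutation consisting of a single $n$-cycle (i.e. "vertex $\sigma(i)$ follows vertex $i$" describes a hamiltonian circuit of the complete directed graph on $1,\ldots,n$). The hamiltonian circuit polytope $H_n(v)\subset\mathbb{R}^n$ is the convex hull of all circuits. The dimension of a polytope is the dimension of its affine hull. *)

theory Defs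
  imports "HOL-Analysis.Analysis" "HOL-Combinatorics.Orbits"
begin

definition n_cycle :: "('n \<Rightarrow> 'n) \<Rightarrow> bool" where
  "n_cycle \<sigma> \<longleftrightarrow> \<sigma> permutes UNIV \<and> cyclic_on \<sigma> UNIV"

text \<open>
  When the components of \<open>v\<close> are pairwise distinct, the map \<open>\<sigma>\<close> below is determined by \<open>x\<close>.
\<close>

definition circuit :: "real ^ 'n \<Rightarrow> real ^ 'n \<Rightarrow> bool" where
  "circuit v x \<longleftrightarrow> (\<exists>\<sigma>. (\<forall>i. x $ i = v $ \<sigma> i) \<and> n_cycle \<sigma>)"

definition ham_circuit_polytope :: "real ^ 'n \<Rightarrow> (real ^ 'n) set" where
  "ham_circuit_polytope v = convex hull {x. circuit v x}"

end

theory Submission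
  imports Defs "HOL-Combinatorics.Cycles"
begin

text \<open>
  The dimension is read off from the linear functionals that are constant on the circuits.
  Passing from a point set to the span \<open>L\<close> of its differences, a functional \<open>a\<close> is constant
  on the set iff \<open>a\<close> lies in the orthogonal complement of \<open>L\<close>, so the affine dimension is
  \<open>n\<close> minus the dimension of the space of these functionals
  (\<open>aff_dim_from_constant_functionals\<close>).

  Every circuit is a rearrangement of the entries of \<open>v\<close>, so the sum of the coordinates is
  always constant.  The theorem for \<open>n \<ge> 4\<close> says that, up to scaling, no other functional is.
  Let \<open>a\<close> be constant on the circuits.  For distinct \<open>i, j, k, l\<close> there is a tour that begins
  with the path \<open>i \<rightarrow> j \<rightarrow> k \<rightarrow> l\<close>, and replacing the path by \<open>i \<rightarrow> k \<rightarrow> j \<rightarrow> l\<close> gives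
  another tour.  The two circuits differ in the coordinates \<open>i, j, k\<close> only, which yields the
  \<^emph>\<open>exchange relation\<close>
  \<open>a\<^sub>i (v\<^sub>j - v\<^sub>k) + a\<^sub>j (v\<^sub>k - v\<^sub>l) + a\<^sub>k (v\<^sub>l - v\<^sub>j) = 0\<close>.
  Keep \<open>l\<close> and permute \<open>i, j, k\<close> cyclically: the three relations so obtained combine to
  \<open>2 (a\<^sub>i - a\<^sub>k) (v\<^sub>j - v\<^sub>l) = 0\<close>.  As the entries of \<open>v\<close> are distinct, \<open>a\<^sub>i = a\<^sub>k\<close>; and \<open>i, k\<close>
  were arbitrary, so \<open>a\<close> is a multiple of the sum of the coordinates.

  With fewer than four vertices there is no room for the exchange, but then the circuits can
  be listed: there is one for \<open>n = 2\<close>, and there are two (the two orientations of a triangle)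
  for \<open>n = 3\<close>.
\<close>

section \<open>Affine dimension and functionals constant on a set\<close>

text \<open>
  The functionals that are constant on \<open>S\<close> form the orthogonal complement of the span of the
  differences \<open>x - p\<close>; here this complement is the line through \<open>u\<close>.
\<close>

lemma aff_dim_from_constant_functionals:
  fixes S :: "'a::euclidean_space set"
  assumes "S \<noteq> {}" "u \<noteq> 0"
    and const: "\<And>a. (\<forall>x\<in>S. \<forall>y\<in>S. a \<bullet> x = a \<bullet> y) \<longleftrightarrow> a \<in> span {u}"
  shows "aff_dim S = int DIM('a) - 1"
proof -
  obtain p where p: "p \<in> S"
    using assms(1) by blast
  define L where "L = span ((\<lambda>x. x - p) ` S)"
  have "(\<forall>x\<in>L. orthogonal x a) \<longleftrightarrow> a \<in> span {u}" for a
  proof -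
    have "(\<forall>x\<in>L. orthogonal x a) \<longleftrightarrow> (\<forall>x\<in>S. orthogonal a (x - p))"
    proof (intro iffI ballI)
      show "orthogonal a (x - p)" if "\<forall>x\<in>L. orthogonal x a" "x \<in> S" for x
        using that unfolding L_def by (metis image_eqI orthogonal_commute span_base)
      show "orthogonal x a" if "\<forall>x\<in>S. orthogonal a (x - p)" "x \<in> L" for x
        using that unfolding L_def
        by (metis (no_types, lifting) imageE orthogonal_commute orthogonal_to_span)
    qed
    also have "\<dots> \<longleftrightarrow> (\<forall>x\<in>S. a \<bullet> x = a \<bullet> p)"
      by (simp add: orthogonal_def inner_diff_right)
    also have "\<dots> \<longleftrightarrow> (\<forall>x\<in>S. \<forall>y\<in>S. a \<bullet> x = a \<bullet> y)"
      using p by metis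
    finally show ?thesis
      using const by simp
  qed
  then have "dim (span {u}) + dim L = DIM('a)"
    using dim_subspace_orthogonal_to_vectors[of L UNIV] by (simp add: L_def)
  then have "dim L = DIM('a) - 1"
    using assms(2) by simp
  moreover have "aff_dim S = int (dim L)"
    unfolding L_def dim_span by (rule aff_dim_eq_dim_subtract) (simp add: p hull_inc)
  ultimately show ?thesis
    by (simp add: of_nat_diff Suc_le_eq)
qed

section \<open>Tours as circuits\<close>

text \<open>
  Iterating the cycle \<open>m\<close> times rotates its list by \<open>m\<close> places, so the head of the list
  visits every entry.
\<close>

lemma n_cycle_cycle_of_list:
  assumes "distinct xs" "set xs = (UNIV :: 'n set)"
  shows "n_cycle (cycle_of_list xs)"
proof -
  let ?c = "cycle_of_list xs"
  have perm: "?c permutes UNIV"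
    using cycle_permutes[of xs] assms(2) by simp
  have ne: "xs \<noteq> []"
    using assms(2) by auto
  have "y \<in> orbit ?c (hd xs)" for y
  proof -
    obtain m where m: "m < length xs" "y = xs ! m"
      using assms(2) by (metis UNIV_I in_set_conv_nth)
    have "(?c ^^ m) (hd xs) = hd (map (?c ^^ m) xs)"
      using ne by (simp add: hd_map)
    also have "\<dots> = y"
      using m ne by (simp add: cyclic_rotation[OF assms(1)] hd_rotate_conv_nth)
    finally show ?thesis
      using permutation_of_cycle[of xs] by (auto simp: orbit_altdef_permutation)
  qed
  then show ?thesis
    unfolding n_cycle_def cyclic_on_def using perm by blast
qed

definition circuit_of_tour :: "real ^ 'n \<Rightarrow> 'n list \<Rightarrow> real ^ 'n" where
  "circuit_of_tour v xs = (\<chi> i. v $ cycle_of_list xs i)"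

lemma circuit_circuit_of_tour:
  assumes "distinct xs" "set xs = (UNIV :: 'n::finite set)"
  shows "circuit v (circuit_of_tour v xs)"
  unfolding circuit_def circuit_of_tour_def using n_cycle_cycle_of_list[OF assms] by auto

lemma ex_circuit: "\<exists>x. circuit (v :: real ^ 'n::finite) x"
  using finite_distinct_list[OF finite, of "UNIV :: 'n set"] by (metis circuit_circuit_of_tour)

lemma sum_circuit:
  fixes v :: "real ^ 'n::finite"
  assumes "circuit v x"
  shows "sum (($) x) UNIV = sum (($) v) UNIV"
proof -
  obtain \<sigma> where "\<And>i. x $ i = v $ \<sigma> i" "\<sigma> permutes UNIV"
    using assms unfolding circuit_def n_cycle_def by blast
  then show ?thesis
    using sum.permute[of \<sigma> UNIV "($) v"] by (simp add: comp_def)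
qed

section \<open>The exchange relation and the case of at least four vertices\<close>

text \<open>
  Exchanging \<open>j\<close> and \<open>k\<close> alters the successors of \<open>i, j, k\<close> alone.  The vertex \<open>l\<close> has to be
  part of the path: it keeps its own successor, even when that is \<open>i\<close> and \<open>n = 4\<close>.
\<close>

lemma cycle_of_list_exchange:
  assumes "distinct (i # j # k # l # ys)" "m \<notin> {i, j, k}"
  shows "cycle_of_list (i # k # j # l # ys) m = cycle_of_list (i # j # k # l # ys) m"
proof -
  \<comment> \<open>Both cycles arise from the cycle through the common tail, which avoids \<open>i, j, k\<close>.\<close>
  define z where "z = cycle_of_list (l # ys) m"
  have "z \<notin> {i, j, k}"
  proof (cases "m \<in> set (l # ys)")
    case True
    then have "z \<in> set (l # ys)"
      unfolding z_def by (simp only: permutes_in_image[OF cycle_permutes])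
    then show ?thesis
      using assms(1) by auto
  next
    case False
    then show ?thesis
      using assms(2) id_outside_supp[of m "l # ys"] by (simp add: z_def)
  qed
  then show ?thesis
    using assms(1) by (auto simp: Transposition.transpose_def simp flip: z_def)
qed

lemma cycle_of_list_path:
  assumes "distinct (i # j # k # l # ys)"
  shows "cycle_of_list (i # j # k # l # ys) i = j"
    and "cycle_of_list (i # j # k # l # ys) j = k"
    and "cycle_of_list (i # j # k # l # ys) k = l"
  using assms id_outside_supp[of _ "l # ys"] by (auto simp: Transposition.transpose_def)

text \<open>
  Compare the two tours through \<open>i \<rightarrow> j \<rightarrow> k \<rightarrow> l\<close> and \<open>i \<rightarrow> k \<rightarrow> j \<rightarrow> l\<close> that visit the remaining
  vertices in the same order.
\<close>

lemma exchange_relation: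
  fixes v a :: "real ^ 'n::finite"
  assumes const: "\<And>x y. circuit v x \<Longrightarrow> circuit v y \<Longrightarrow> a \<bullet> x = a \<bullet> y"
    and dist: "distinct [i, j, k, l]"
  shows "a $ i * (v $ j - v $ k) + a $ j * (v $ k - v $ l) + a $ k * (v $ l - v $ j) = 0"
proof -
  obtain ys where ys: "set ys = UNIV - {i, j, k, l}" "distinct ys"
    using finite_distinct_list[of "UNIV - {i, j, k, l}"] by auto
  let ?P = "i # j # k # l # ys" and ?Q = "i # k # j # l # ys"
  have P: "distinct ?P" "set ?P = UNIV" and Q: "distinct ?Q" "set ?Q = UNIV"
    using ys dist by auto
  let ?x = "circuit_of_tour v ?P" and ?y = "circuit_of_tour v ?Q"
  have "0 = a \<bullet> (?x - ?y)"
    using const[OF circuit_circuit_of_tour[OF P] circuit_circuit_of_tour[OF Q]]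
    by (simp add: inner_diff_right)
  also have "\<dots> = (\<Sum>m\<in>UNIV. a $ m * (?x $ m - ?y $ m))"
    by (simp add: inner_vec_def)
  also have "\<dots> = (\<Sum>m\<in>{i, j, k}. a $ m * (?x $ m - ?y $ m))"
    by (rule sum.mono_neutral_right)
      (use cycle_of_list_exchange[OF P(1)] in \<open>auto simp: circuit_of_tour_def simp del: cycle_of_list.simps\<close>)
  also have "\<dots> = a $ i * (v $ j - v $ k) + a $ j * (v $ k - v $ l) + a $ k * (v $ l - v $ j)"
    using dist
    by (simp add: circuit_of_tour_def cycle_of_list_path[OF P(1)] cycle_of_list_path[OF Q(1)]
        del: cycle_of_list.simps)
  finally show ?thesis
    by simp
qed

text \<open>
  Four vertices are what the argument needs: besides the pair \<open>i, k\<close> to be compared, one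
  vertex \<open>j\<close> to exchange and one vertex \<open>l\<close> to end the path.
\<close>

lemma constant_functional_coords_eq:
  fixes v a :: "real ^ 'n::finite"
  assumes card: "CARD('n) \<ge> 4" and inj: "inj (($) v)"
    and const: "\<And>x y. circuit v x \<Longrightarrow> circuit v y \<Longrightarrow> a \<bullet> x = a \<bullet> y"
  shows "a $ i = a $ k"
proof (cases "i = k")
  case False
  have "card (UNIV - {i, k}) \<ge> 2"
    using card False by (simp add: card_Diff_subset)
  then obtain T where "T \<subseteq> UNIV - {i, k}" "card T = 2"
    by (meson obtain_subset_with_card_n)
  then obtain j l where "distinct [i, j, k, l]"
    using False by (auto simp: card_2_iff)
  then have *: "distinct [i, j, k, l]" "distinct [j, k, i, l]" "distinct [k, i, j, l]"
    by auto
  \<comment> \<open>First relation minus the second plus the third: \<open>a\<^sub>j\<close> cancels.\<close>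
  have "2 * ((a $ i - a $ k) * (v $ j - v $ l)) = 0"
    using exchange_relation[of v a, OF const *(1)] exchange_relation[of v a, OF const *(2)]
      exchange_relation[of v a, OF const *(3)]
    by (simp add: algebra_simps)
  moreover have "v $ j \<noteq> v $ l"
    using * inj by (auto dest: injD)
  ultimately show ?thesis
    by simp
qed simp

lemma aff_dim_circuits_ge_4:
  fixes v :: "real ^ 'n::finite"
  assumes "CARD('n) \<ge> 4" and "inj (($) v)"
  shows "aff_dim {x. circuit v x} = int CARD('n) - 1"
proof -
  have "(\<forall>x\<in>{x. circuit v x}. \<forall>y\<in>{x. circuit v x}. a \<bullet> x = a \<bullet> y) \<longleftrightarrow> a \<in> span {1}"
    (is "?const \<longleftrightarrow> _") for a :: "real ^ 'n"
  proof
    assume ?const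
    then have "a $ i = a $ k" for i k
      using constant_functional_coords_eq[OF assms, of a] by blast
    then have "a = (a $ undefined) *\<^sub>R 1"
      by (simp add: vec_eq_iff)
    then show "a \<in> span {1}"
      by (auto simp: span_singleton)
  next
    assume "a \<in> span {1}"
    then obtain t where "a = t *\<^sub>R 1"
      by (auto simp: span_singleton)
    then have "a \<bullet> x = t * sum (($) x) UNIV" for x
      by (simp add: inner_vec_def sum_distrib_left)
    then show ?const
      by (simp add: sum_circuit)
  qed
  then show ?thesis
    using aff_dim_from_constant_functionals[of "{x. circuit v x}" 1] ex_circuit[of v] by simp
qed

section \<open>Two and three vertices\<close>

lemma n_cycle_no_fixpoint:
  fixes \<sigma> :: "'n::finite \<Rightarrow> 'n"
  assumes "n_cycle \<sigma>" "CARD('n) \<ge> 2"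
  shows "\<sigma> i \<noteq> i"
proof
  assume fp: "\<sigma> i = i"
  have "x = i" if "x \<in> orbit \<sigma> i" for x
    using that by induction (simp_all add: fp)
  moreover have "orbit \<sigma> i = UNIV"
    using assms(1) unfolding n_cycle_def cyclic_on_alldef by auto
  ultimately have "(UNIV :: 'n set) = {i}"
    by auto
  then have "CARD('n) = card {i}"
    by (rule arg_cong)
  then show False
    using assms(2) by simp
qed

lemma aff_dim_circuits_2:
  fixes v :: "real ^ 'n::finite"
  assumes "CARD('n) = 2"
  shows "aff_dim {x. circuit v x} = 0"
proof -
  obtain a b :: 'n where ab: "UNIV = {a, b}" "a \<noteq> b"
    using assms by (auto simp: card_2_iff)
  have "x = y" if "circuit v x" "circuit v y" for x y
  proof -
    have swap: "n_cycle \<sigma> \<Longrightarrow> \<sigma> a = b \<and> \<sigma> b = a" for \<sigma>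
      using n_cycle_no_fixpoint[of \<sigma> a] n_cycle_no_fixpoint[of \<sigma> b] assms ab(1) by auto
    obtain \<sigma> \<tau> where "\<And>i. x $ i = v $ \<sigma> i" "n_cycle \<sigma>" "\<And>i. y $ i = v $ \<tau> i" "n_cycle \<tau>"
      using \<open>circuit v x\<close> \<open>circuit v y\<close> unfolding circuit_def by blast
    then have "\<forall>i\<in>{a, b}. x $ i = y $ i"
      using swap[of \<sigma>] swap[of \<tau>] by simp
    then show ?thesis
      by (simp add: vec_eq_iff flip: ab(1))
  qed
  then obtain x where "{x. circuit v x} = {x}"
    using ex_circuit[of v] by blast
  then show ?thesis
    by simp
qed

lemma aff_dim_circuits_3:
  fixes v :: "real ^ 'n::finite"
  assumes "CARD('n) = 3" and inj: "inj (($) v)"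
  shows "aff_dim {x. circuit v x} = 1"
proof -
  obtain a b c :: 'n where abc: "UNIV = {a, b, c}" "a \<noteq> b" "a \<noteq> c" "b \<noteq> c"
    using assms(1) by (auto simp: card_3_iff)
  let ?x = "circuit_of_tour v [a, b, c]" and ?y = "circuit_of_tour v [a, c, b]"
  have x: "?x $ a = v $ b" "?x $ b = v $ c" "?x $ c = v $ a"
    and y: "?y $ a = v $ c" "?y $ b = v $ a" "?y $ c = v $ b"
    using abc by (simp_all add: circuit_of_tour_def Transposition.transpose_def)
  have "z \<in> {?x, ?y}" if z: "circuit v z" for z
  proof -
    obtain \<sigma> where \<sigma>: "\<And>i. z $ i = v $ \<sigma> i" "n_cycle \<sigma>"
      using z unfolding circuit_def by blast
    have nofix: "\<sigma> i \<noteq> i" for i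
      using n_cycle_no_fixpoint[OF \<sigma>(2)] assms(1) by simp
    have "inj \<sigma>"
      using \<sigma>(2) unfolding n_cycle_def by (blast intro: permutes_inj)
    then have "distinct [\<sigma> a, \<sigma> b, \<sigma> c]"
      using abc by (auto dest: injD)
    moreover have "\<sigma> a \<in> {b, c}" "\<sigma> b \<in> {a, c}" "\<sigma> c \<in> {a, b}"
      using nofix[of a] nofix[of b] nofix[of c] abc(1) by blast+
    \<comment> \<open>The two derangements of three points are the two orientations of the triangle.\<close>
    ultimately have "\<sigma> a = b \<and> \<sigma> b = c \<and> \<sigma> c = a \<or> \<sigma> a = c \<and> \<sigma> b = a \<and> \<sigma> c = b"
      by auto
    then have "(\<forall>i\<in>{a, b, c}. z $ i = ?x $ i) \<or> (\<forall>i\<in>{a, b, c}. z $ i = ?y $ i)"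
      using x y by (auto simp: \<sigma>(1))
    then show ?thesis
      by (simp add: vec_eq_iff flip: abc(1))
  qed
  moreover have "circuit v ?x" "circuit v ?y"
    using abc by (auto intro!: circuit_circuit_of_tour)
  ultimately have "{x. circuit v x} = {?x, ?y}"
    by blast
  moreover have "?x \<noteq> ?y"
    using x(1) y(1) injD[OF inj, of b c] abc by auto
  ultimately show ?thesis
    by simp
qed

section \<open>Dimension of the hamiltonian circuit polytope\<close>

theorem theorem1:
  fixes v :: "real ^ 'n::{finite,linorder}"
  assumes "CARD('n) \<ge> 2"
    and "\<And>i. 0 \<le> v $ i"
    and "strict_mono (\<lambda>i. v $ i)"
  shows "aff_dim (ham_circuit_polytope v) =
    (if CARD('n) \<in> {2, 3} then int CARD('n) - 2 else int CARD('n) - 1)"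
proof -
  have inj: "inj (($) v)"
    using assms(3) by (rule strict_mono_imp_inj_on)
  consider "CARD('n) = 2" | "CARD('n) = 3" | "CARD('n) \<ge> 4"
    using assms(1) by linarith
  then show ?thesis
    unfolding ham_circuit_polytope_def aff_dim_convex_hull
    by cases (simp_all add: aff_dim_circuits_2 aff_dim_circuits_3[OF _ inj]
        aff_dim_circuits_ge_4[OF _ inj])
qed

end
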